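(* Let $S$ be a semigroup and let $A$ be a finite set with more than one element. Then the following conditions are equivalent: (a) the dynamical system $(A^S,S)$ is expansive; (b) there exists a finite subset $K\subset S$ such that $S=KS$.
   Context: $KS=\{ks: k\in K, s\in S\}$. $A^S$ is the set of all maps $S\to A$ with the prodiscrete topology (product topology with each factor $A$ discrete), which is compact Hausdorff. $S$ acts continuously on $A^S$ by the shift $(sx)(s')=x(s's)$ for $s,s'\in S$, $x\in A^S$; $(A^S,S)$ denotes this dynamical system. A compact Hausdorff space $X$ carries a unique uniform structure inducing its topology; its entourages are the neighborhoods of the diagonal in $X\times X$. A continuous action of $S$ on $X$ is expansive if there is an entourage $E$ of $X$ such that for all distinct $x,y\in X$ there exists $s\in S$ with $(sx,sy)\notin E$. *)

theory Defs
  imports "HOL-Analysis.Analysis"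
begin

text \<open>
  The semigroup is the whole type \<open>'s :: semigroup_mult\<close>; it carries no topology, so an action is
  continuous when each of its elements acts by a continuous self-map.
\<close>

locale semigroup_dynamical_system =
  fixes X :: "'x topology" and act :: "'s::semigroup_mult \<Rightarrow> 'x \<Rightarrow> 'x"
  assumes compact: "compact_space X"
    and Hausdorff: "Hausdorff_space X"
    and continuous: "continuous_map X X (act s)"
    and act_mult: "x \<in> topspace X \<Longrightarrow> act (s * t) x = act s (act t x)"

text \<open>
  On a compact Hausdorff space, the neighbourhoods of the diagonal are the entourages of the unique
  compatible uniform structure. They are used directly here because \<open>X\<close> is an abstract topology
  rather than a type of class \<^class>\<open>uniform_space\<close>.
\<close>

definition entourage :: "'x topology \<Rightarrow> ('x \<times> 'x) set \<Rightarrow> bool" where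
  "entourage X E \<longleftrightarrow>
     E \<subseteq> topspace X \<times> topspace X \<and>
     (\<exists>U. openin (prod_topology X X) U \<and> (\<forall>x\<in>topspace X. (x, x) \<in> U) \<and> U \<subseteq> E)"

definition expansive :: "'x topology \<Rightarrow> ('s::semigroup_mult \<Rightarrow> 'x \<Rightarrow> 'x) \<Rightarrow> bool" where
  "expansive X act \<longleftrightarrow>
     (\<exists>E. entourage X E \<and>
       (\<forall>x\<in>topspace X. \<forall>y\<in>topspace X. x \<noteq> y \<longrightarrow> (\<exists>s. (act s x, act s y) \<notin> E)))"

definition prodiscrete :: "'a set \<Rightarrow> ('s \<Rightarrow> 'a) topology" where
  "prodiscrete A = product_topology (\<lambda>_. discrete_topology A) UNIV"

definition shift :: "'s::semigroup_mult \<Rightarrow> ('s \<Rightarrow> 'a) \<Rightarrow> ('s \<Rightarrow> 'a)" where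
  "shift s x = (\<lambda>s'. x (s' * s))"

lemma topspace_prodiscrete: "topspace (prodiscrete A) = {x. range x \<subseteq> A}"
  by (auto simp: prodiscrete_def)

lemma semigroup_dynamical_system_shift:
  assumes "finite A"
  shows "semigroup_dynamical_system (prodiscrete A :: ('s::semigroup_mult \<Rightarrow> 'a) topology) shift"
proof
  show "compact_space (prodiscrete A :: ('s \<Rightarrow> 'a) topology)"
    using assms by (simp add: prodiscrete_def compact_space_product_topology
        compact_space_discrete_topology)
  show "Hausdorff_space (prodiscrete A :: ('s \<Rightarrow> 'a) topology)"
    by (simp add: prodiscrete_def Hausdorff_space_product_topology)
  show "continuous_map (prodiscrete A :: ('s \<Rightarrow> 'a) topology) (prodiscrete A) (shift s)" for s
    unfolding prodiscrete_def shift_def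
    by (subst continuous_map_componentwise_UNIV) 
       (auto intro: continuous_map_product_projection)
  show "shift (s * t) x = shift s (shift t x)" for s t :: 's and x :: "'s \<Rightarrow> 'a"
    by (simp add: shift_def mult.assoc)
qed

end

theory Submission
  imports Defs
begin

text \<open>
  Only finitely many coordinates matter to an entourage of the prodiscrete topology when \<open>A\<close> is
  finite: compactness turns the neighbourhoods of the points of the diagonal into one finite set
  \<open>K\<close> of coordinates such that every pair of configurations agreeing on \<open>K\<close> lies in the entourage,
  and conversely every finite \<open>K\<close> arises in this way (\<open>entourage_prodiscrete_iff\<close>). So expansivity
  says that, for some finite \<open>K\<close>, any two distinct configurations can be shifted so that they
  differ somewhere on \<open>K\<close>.

  Because \<open>(s x)(k) = x (k s)\<close>, the coordinates of \<open>x\<close> that are visible on \<open>K\<close> after some shift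
  are precisely those in \<open>K S\<close>. If \<open>K S = S\<close>, any difference between two configurations is
  visible. If some \<open>t\<close> lies outside \<open>K S\<close>, two configurations that differ only at \<open>t\<close>, which exist
  as soon as \<open>A\<close> has two elements, are never told apart.
\<close>

definition cylinder :: "'a set \<Rightarrow> 's set \<Rightarrow> ('s \<Rightarrow> 'a) \<Rightarrow> ('s \<Rightarrow> 'a) set" where
  "cylinder A K z = {x. range x \<subseteq> A \<and> (\<forall>k\<in>K. x k = z k)}"

text \<open>
  Cylinders over finite sets form a basis: a basic open box constrains only finitely many
  coordinates, and fixing those coordinates keeps a point inside the box.
\<close>

lemma openin_prodiscrete_iff:
  "openin (prodiscrete A) V \<longleftrightarrow>
     (\<forall>z\<in>V. range z \<subseteq> A \<and> (\<exists>K. finite K \<and> cylinder A K z \<subseteq> V))"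
proof
  assume V: "openin (prodiscrete A) V"
  show "\<forall>z\<in>V. range z \<subseteq> A \<and> (\<exists>K. finite K \<and> cylinder A K z \<subseteq> V)"
  proof
    fix z assume z: "z \<in> V"
    then obtain B where B: "finite {i. B i \<noteq> A}" "z \<in> Pi\<^sub>E UNIV B" "Pi\<^sub>E UNIV B \<subseteq> V"
      using V unfolding prodiscrete_def openin_product_topology_alt by auto
    have "x \<in> Pi\<^sub>E UNIV B" if x: "x \<in> cylinder A {i. B i \<noteq> A} z" for x
    proof
      fix i show "x i \<in> B i"
        using x B(2) by (cases "B i = A") (auto simp: cylinder_def PiE_def Pi_def)
    qed auto
    with B(1,3) have "\<exists>K. finite K \<and> cylinder A K z \<subseteq> V" by blast
    moreover have "range z \<subseteq> A"
      using openin_subset[OF V] z by (auto simp: topspace_prodiscrete)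
    ultimately show "range z \<subseteq> A \<and> (\<exists>K. finite K \<and> cylinder A K z \<subseteq> V)" by blast
  qed
next
  assume V: "\<forall>z\<in>V. range z \<subseteq> A \<and> (\<exists>K. finite K \<and> cylinder A K z \<subseteq> V)"
  show "openin (prodiscrete A) V"
    unfolding prodiscrete_def openin_product_topology_alt
  proof
    fix z assume z: "z \<in> V"
    then obtain K where K: "finite K" "cylinder A K z \<subseteq> V" and rz: "range z \<subseteq> A"
      using bspec[OF V z] by (elim conjE exE)
    let ?B = "\<lambda>i. if i \<in> K then {z i} else A"
    have "finite {i. ?B i \<noteq> A}"
      by (rule finite_subset[OF _ K(1)]) (simp add: subset_iff)
    moreover have "z \<in> Pi\<^sub>E UNIV ?B" using rz by (simp add: PiE_UNIV_domain image_subset_iff)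
    moreover have "x \<in> cylinder A K z" if x: "x \<in> Pi\<^sub>E UNIV ?B" for x
    proof -
      have xi: "x i \<in> ?B i" for i using x by (rule PiE_mem) simp
      have "x i \<in> A" for i using xi[of i] rz by (auto split: if_splits)
      moreover have "x k = z k" if "k \<in> K" for k using xi[of k] that by simp
      ultimately show ?thesis by (auto simp: cylinder_def)
    qed
    ultimately show "\<exists>U. finite {i \<in> UNIV. U i \<noteq> topspace (discrete_topology A)} \<and>
        (\<forall>i\<in>UNIV. openin (discrete_topology A) (U i)) \<and> z \<in> Pi\<^sub>E UNIV U \<and> Pi\<^sub>E UNIV U \<subseteq> V"
      using K(2) rz by (intro exI[of _ ?B]) auto
  qed
qed

lemma self_in_cylinder: "range z \<subseteq> A \<Longrightarrow> z \<in> cylinder A K z"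
  by (simp add: cylinder_def)

lemma openin_cylinder:
  assumes "finite K"
  shows "openin (prodiscrete A) (cylinder A K z)"
  unfolding openin_prodiscrete_iff
proof
  fix x assume x: "x \<in> cylinder A K z"
  then have "cylinder A K x \<subseteq> cylinder A K z" by (auto simp: cylinder_def)
  with x assms show "range x \<subseteq> A \<and> (\<exists>L. finite L \<and> cylinder A L x \<subseteq> cylinder A K z)"
    by (auto simp: cylinder_def)
qed

text \<open>
  Around each diagonal point \<open>(z, z)\<close> some square \<open>C \<times> C\<close> of a cylinder over a finite set \<open>L z\<close>
  lies in a given neighbourhood of the diagonal. Finitely many of these cylinders cover the
  compact space; let \<open>K\<close> be the union of their sets \<open>L z\<close>. If \<open>x\<close> lies in one of these cylinders,
  so does every \<open>y\<close> that agrees with \<open>x\<close> on \<open>K\<close>, whence \<open>(x, y)\<close> is in the neighbourhood.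
\<close>

lemma diagonal_neighbourhood_prodiscrete:
  assumes "finite A"
    and U: "openin (prod_topology (prodiscrete A) (prodiscrete A)) U"
    and diag: "\<And>x. range x \<subseteq> A \<Longrightarrow> (x, x) \<in> U"
  obtains K where "finite K"
    and "\<And>x y. range x \<subseteq> A \<Longrightarrow> range y \<subseteq> A \<Longrightarrow> (\<forall>k\<in>K. x k = y k) \<Longrightarrow> (x, y) \<in> U"
proof -
  have local_square: "\<exists>L. finite L \<and> cylinder A L z \<times> cylinder A L z \<subseteq> U" if z: "range z \<subseteq> A" for z
  proof -
    obtain V W where VW: "openin (prodiscrete A) V" "openin (prodiscrete A) W"
        "z \<in> V" "z \<in> W" "V \<times> W \<subseteq> U"
      using U diag[OF z] unfolding openin_prod_topology_alt by meson
    have "openin (prodiscrete A) (V \<inter> W)" using VW(1,2) by (rule openin_Int)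
    then obtain L where "finite L" "cylinder A L z \<subseteq> V \<inter> W"
      using VW unfolding openin_prodiscrete_iff[of A "V \<inter> W"] by blast
    then show ?thesis using VW(5) by blast
  qed
  obtain L where L: "\<And>z. range z \<subseteq> A \<Longrightarrow> finite (L z)"
      "\<And>z. range z \<subseteq> A \<Longrightarrow> cylinder A (L z) z \<times> cylinder A (L z) z \<subseteq> U"
    using local_square by metis
  let ?X = "topspace (prodiscrete A) :: ('b \<Rightarrow> 'a) set"
  let ?C = "\<lambda>z. cylinder A (L z) z"
  have "compact_space (prodiscrete A :: ('b \<Rightarrow> 'a) topology)"
    using \<open>finite A\<close> by (simp add: prodiscrete_def compact_space_product_topology
        compact_space_discrete_topology)
  moreover have "\<forall>V\<in>?C ` ?X. openin (prodiscrete A) V"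
    by (auto simp: topspace_prodiscrete intro: openin_cylinder L(1))
  moreover have "?X \<subseteq> \<Union>(?C ` ?X)"
    using self_in_cylinder by (fastforce simp: topspace_prodiscrete)
  ultimately obtain F where F: "finite F" "F \<subseteq> ?C ` ?X" "?X \<subseteq> \<Union>F"
    unfolding compact_space_alt by meson
  obtain Z where Z: "finite Z" "Z \<subseteq> ?X" "F = ?C ` Z"
    using finite_subset_image[OF F(1,2)] by blast
  show thesis
  proof
    show "finite (\<Union>z\<in>Z. L z)" using Z L(1) by (auto simp: topspace_prodiscrete)
    fix x y assume xy: "range x \<subseteq> A" "range y \<subseteq> A" "\<forall>k\<in>(\<Union>z\<in>Z. L z). x k = y k"
    obtain z where z: "z \<in> Z" "x \<in> ?C z"
      using F(3) Z(3) xy(1) unfolding topspace_prodiscrete by blast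
    then have "y \<in> ?C z" using xy by (auto simp: cylinder_def)
    then show "(x, y) \<in> U" using z L(2)[of z] Z(2) by (auto simp: topspace_prodiscrete)
  qed
qed

text \<open>
  The sets of pairs agreeing on a finite \<open>K\<close> form a base of the uniform structure: the diagonal
  lemma gives one direction, and for the other the relation of agreeing on \<open>K\<close> is itself open,
  being a union of products of cylinders.
\<close>

lemma entourage_prodiscrete_iff:
  assumes "finite A"
  shows "entourage (prodiscrete A) E \<longleftrightarrow>
    E \<subseteq> {x. range x \<subseteq> A} \<times> {y. range y \<subseteq> A} \<and>
    (\<exists>K. finite K \<and>
      (\<forall>x y. range x \<subseteq> A \<longrightarrow> range y \<subseteq> A \<longrightarrow> (\<forall>k\<in>K. x k = y k) \<longrightarrow> (x, y) \<in> E))"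
    (is "_ \<longleftrightarrow> ?sub \<and> (\<exists>K. finite K \<and> ?agree K)")
proof
  assume E: "entourage (prodiscrete A) E"
  then obtain U where U: "openin (prod_topology (prodiscrete A) (prodiscrete A)) U"
      "\<And>x. range x \<subseteq> A \<Longrightarrow> (x, x) \<in> U" "U \<subseteq> E"
    unfolding entourage_def topspace_prodiscrete by blast
  obtain K where "finite K"
      "\<And>x y. range x \<subseteq> A \<Longrightarrow> range y \<subseteq> A \<Longrightarrow> (\<forall>k\<in>K. x k = y k) \<Longrightarrow> (x, y) \<in> U"
    using diagonal_neighbourhood_prodiscrete[OF assms U(1,2)] by blast
  then have "finite K \<and> ?agree K" using U(3) by blast
  moreover have ?sub using E by (simp add: entourage_def topspace_prodiscrete)
  ultimately show "?sub \<and> (\<exists>K. finite K \<and> ?agree K)" by blast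
next
  assume "?sub \<and> (\<exists>K. finite K \<and> ?agree K)"
  then obtain K where sub: ?sub and K: "finite K" and agree: "?agree K" by blast
  let ?U = "{(x, y). range x \<subseteq> A \<and> range y \<subseteq> A \<and> (\<forall>k\<in>K. x k = y k)}"
  have "openin (prod_topology (prodiscrete A) (prodiscrete A)) ?U"
    unfolding openin_prod_topology_alt
  proof (intro allI impI)
    fix x y assume xy: "(x, y) \<in> ?U"
    then have "cylinder A K x \<times> cylinder A K y \<subseteq> ?U" by (auto simp: cylinder_def)
    with xy show "\<exists>V W. openin (prodiscrete A) V \<and> openin (prodiscrete A) W \<and>
        x \<in> V \<and> y \<in> W \<and> V \<times> W \<subseteq> ?U"
      by (rule_tac x = "cylinder A K x" in exI, rule_tac x = "cylinder A K y" in exI)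
        (simp add: self_in_cylinder openin_cylinder[OF K])
  qed
  moreover have "?U \<subseteq> E" using agree by auto
  moreover have "\<forall>x\<in>topspace (prodiscrete A). (x, x) \<in> ?U"
    by (simp add: topspace_prodiscrete)
  ultimately show "entourage (prodiscrete A) E"
    using sub unfolding entourage_def topspace_prodiscrete by blast
qed

theorem proposition4p2:
  fixes A :: "'a set"
  assumes "finite A" and "card A > 1"
  shows "expansive (prodiscrete A :: ('s::semigroup_mult \<Rightarrow> 'a) topology) shift \<longleftrightarrow>
    (\<exists>K :: 's set. finite K \<and> UNIV = {k * s | k s. k \<in> K \<and> s \<in> UNIV})"
proof
  assume "expansive (prodiscrete A :: ('s \<Rightarrow> 'a) topology) shift"
  then obtain E :: "(('s \<Rightarrow> 'a) \<times> ('s \<Rightarrow> 'a)) set" where E: "entourage (prodiscrete A) E"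
    and sep: "\<And>x y. range x \<subseteq> A \<Longrightarrow> range y \<subseteq> A \<Longrightarrow> x \<noteq> y \<Longrightarrow> \<exists>s. (shift s x, shift s y) \<notin> E"
    unfolding expansive_def topspace_prodiscrete by blast
  obtain K where K: "finite K"
    and agree: "\<And>x y. range x \<subseteq> A \<Longrightarrow> range y \<subseteq> A \<Longrightarrow> (\<forall>k\<in>K. x k = y k) \<Longrightarrow> (x, y) \<in> E"
    using E unfolding entourage_prodiscrete_iff[OF \<open>finite A\<close>] by blast
  obtain a b where ab: "a \<in> A" "b \<in> A" "a \<noteq> b"
    using \<open>card A > 1\<close> by (metis card_le_Suc0_iff_eq[OF \<open>finite A\<close>] One_nat_def not_le)
  have "t \<in> {k * s | k s. k \<in> K \<and> s \<in> UNIV}" for t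
  proof (rule ccontr)
    assume t: "t \<notin> {k * s | k s. k \<in> K \<and> s \<in> UNIV}"
    let ?x = "\<lambda>_. a" and ?y = "(\<lambda>_. a)(t := b)"
    have "?x \<noteq> ?y" using ab(3) by (metis fun_upd_same)
    then obtain s where s: "(shift s ?x, shift s ?y) \<notin> E"
      using sep[of ?x ?y] ab by auto
    have "shift s ?x k = shift s ?y k" if "k \<in> K" for k
      using t that by (auto simp: shift_def)
    then have "(shift s ?x, shift s ?y) \<in> E"
      using ab by (intro agree) (auto simp: shift_def)
    with s show False by contradiction
  qed
  with K show "\<exists>K :: 's set. finite K \<and> UNIV = {k * s | k s. k \<in> K \<and> s \<in> UNIV}"
    by blast
next
  assume "\<exists>K :: 's set. finite K \<and> UNIV = {k * s | k s. k \<in> K \<and> s \<in> UNIV}"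
  then obtain K :: "'s set" where K: "finite K" and
    UNIV_eq: "UNIV = {k * s | k s. k \<in> K \<and> s \<in> UNIV}" by blast
  have cover: "\<exists>k\<in>K. \<exists>s. t = k * s" for t
    using UNIV_eq by blast
  let ?E = "{(x, y). range x \<subseteq> A \<and> range y \<subseteq> A \<and> (\<forall>k\<in>K. x k = y k)}"
  have "entourage (prodiscrete A) ?E"
    unfolding entourage_prodiscrete_iff[OF \<open>finite A\<close>] using K by auto
  moreover have "\<exists>s. (shift s x, shift s y) \<notin> ?E" if "x \<noteq> y" for x y :: "'s \<Rightarrow> 'a"
  proof -
    obtain t where "x t \<noteq> y t" using \<open>x \<noteq> y\<close> by blast
    moreover obtain k s where ks: "k \<in> K" "t = k * s" using cover by blast
    ultimately have "shift s x k \<noteq> shift s y k" by (simp add: shift_def)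
    with ks(1) show ?thesis by blast
  qed
  ultimately show "expansive (prodiscrete A :: ('s \<Rightarrow> 'a) topology) shift"
    unfolding expansive_def by blast
qed

end
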